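(* Let $G$ be a group, considered as a quandle under conjugation $x\triangleleft y=y^{-1}xy$, let $k$ be a field, and let $c:G^3\to k$ satisfy $$c(x,y,z)+c(x,yz,w)=c(x\triangleleft y,z,w)+c(x,y,zw)\qquad\text{for all }x,y,z,w\in G.$$ Then $\theta:G^3\to k$ defined by $\theta(x,y,z)=c(x,y,z)-c(x,z,z^{-1}yz)$ is a rack $3$-cocycle, i.e. for all $x,y,z,w\in G$, $$\theta(x,y,z)+\theta(x\triangleleft z,y\triangleleft z,w)+\theta(x,z,w)=\theta(x\triangleleft y,z,w)+\theta(x,y,w)+\theta(x\triangleleft w,y\triangleleft w,z\triangleleft w).$$
   Context: For $x,y$ in a group $G$, $x\triangleleft y:=y^{-1}xy$. The displayed identity in the conclusion is the rack $3$-cocycle condition. *)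

theory Defs
  imports "HOL-Algebra.Ring"
begin

definition conj_op :: "('a, 'm) monoid_scheme \<Rightarrow> 'a \<Rightarrow> 'a \<Rightarrow> 'a"
    (infixl \<open>\<triangleleft>\<index>\<close> 75)
  where "x \<triangleleft>\<^bsub>G\<^esub> y = inv\<^bsub>G\<^esub> y \<otimes>\<^bsub>G\<^esub> x \<otimes>\<^bsub>G\<^esub> y"

text \<open>
  Rack \<open>3\<close>-cocycles on the carrier \<open>Q\<close> with operation \<open>op\<close>, with values in the additive
  group of \<open>K\<close>. The rack axioms for \<open>(Q, op)\<close> are not part of the predicate.
\<close>
definition rack_3_cocycle ::
    "'a set \<Rightarrow> ('a \<Rightarrow> 'a \<Rightarrow> 'a) \<Rightarrow> ('k, 'n) ring_scheme \<Rightarrow> ('a \<Rightarrow> 'a \<Rightarrow> 'a \<Rightarrow> 'k) \<Rightarrow> bool"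
  where "rack_3_cocycle Q op K \<theta> \<longleftrightarrow>
    \<theta> \<in> Q \<rightarrow> Q \<rightarrow> Q \<rightarrow> carrier K \<and>
    (\<forall>x\<in>Q. \<forall>y\<in>Q. \<forall>z\<in>Q. \<forall>w\<in>Q.
      \<theta> x y z \<oplus>\<^bsub>K\<^esub> \<theta> (op x z) (op y z) w \<oplus>\<^bsub>K\<^esub> \<theta> x z w =
      \<theta> (op x y) z w \<oplus>\<^bsub>K\<^esub> \<theta> x y w \<oplus>\<^bsub>K\<^esub> \<theta> (op x w) (op y w) (op z w))"

end

theory Submission
  imports Defs
begin

text \<open>
  Write \<open>T x y z w\<close> for the hypothesis on \<open>c\<close> at \<open>(x, y, z, w)\<close>. The group law gives
  \<open>y z = z (y \<triangleleft> z)\<close>, so the six words obtained by sorting \<open>y, z, w\<close> in all orders, with the letters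
  conjugated accordingly, represent the same element. The cocycle condition is
  the alternating sum of the instances of \<open>T x\<close> at these six words; the terms of the form
  \<open>c x (a b) d\<close> and \<open>c x a (b d)\<close> cancel in pairs around the hexagon.
\<close>

context group
begin

lemma conj_op_closed [simp, intro]:
  "\<lbrakk>x \<in> carrier G; y \<in> carrier G\<rbrakk> \<Longrightarrow> x \<triangleleft> y \<in> carrier G"
  by (simp add: conj_op_def)

lemma mult_conj_op: "\<lbrakk>x \<in> carrier G; y \<in> carrier G\<rbrakk> \<Longrightarrow> y \<otimes> (x \<triangleleft> y) = x \<otimes> y"
  by (simp add: conj_op_def m_assoc[symmetric])

lemma conj_op_mult_right:
  "\<lbrakk>x \<in> carrier G; y \<in> carrier G; z \<in> carrier G\<rbrakk> \<Longrightarrow> x \<triangleleft> (y \<otimes> z) = x \<triangleleft> y \<triangleleft> z"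
  by (simp add: conj_op_def inv_mult_group m_assoc)

lemma conj_op_mult_left:
  assumes "x \<in> carrier G" "y \<in> carrier G" "z \<in> carrier G"
  shows "(x \<otimes> y) \<triangleleft> z = (x \<triangleleft> z) \<otimes> (y \<triangleleft> z)"
proof -
  have "z \<otimes> (inv z \<otimes> (y \<otimes> z)) = y \<otimes> z"
    using assms by (simp add: m_assoc[symmetric])
  then show ?thesis
    using assms by (simp add: conj_op_def m_assoc)
qed

text \<open>Conjugating by \<open>z\<close> and then by \<open>y \<triangleleft> z\<close> is
  conjugating by their product, which is \<open>y \<otimes> z\<close>. This is the self-distributive
  law of a quandle.\<close>

lemma conj_op_distrib:
  assumes "x \<in> carrier G" "y \<in> carrier G" "z \<in> carrier G"
  shows "(x \<triangleleft> z) \<triangleleft> (y \<triangleleft> z) = (x \<triangleleft> y) \<triangleleft> z"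
  using assms by (simp add: conj_op_mult_right[symmetric] mult_conj_op)

end

lemma (in abelian_group) minus_add_minus_cancel:
  "\<lbrakk>x \<in> carrier G; y \<in> carrier G; z \<in> carrier G\<rbrakk> \<Longrightarrow> (x \<ominus> y) \<oplus> (y \<ominus> z) = x \<ominus> z"
  by (simp add: minus_eq a_assoc r_neg1)

text \<open>Subtracting the two equations eliminates the shared summand \<open>m\<close>. It serves
  for two instances of the hypothesis on \<open>c\<close> with a common term of the form
  \<open>c x (a b) d\<close>.\<close>

lemma (in abelian_group) add_eq_imp_minus_eq:
  assumes "a \<oplus> m = b \<oplus> n" "a' \<oplus> m = b' \<oplus> n'"
    and carr [simp]: "a \<in> carrier G" "a' \<in> carrier G" "b \<in> carrier G" "b' \<in> carrier G"
      "m \<in> carrier G" "n \<in> carrier G" "n' \<in> carrier G"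
  shows "a \<ominus> a' = (b \<ominus> b') \<oplus> (n \<ominus> n')"
proof -
  have "a \<ominus> a' = a \<oplus> \<ominus> a' \<oplus> (m \<oplus> \<ominus> m)"
    by (simp add: minus_eq r_neg)
  also have "\<dots> = (a \<oplus> m) \<ominus> (a' \<oplus> m)"
    by (simp add: minus_eq minus_add a_ac)
  also have "\<dots> = (b \<ominus> b') \<oplus> (n \<ominus> n')"
    by (simp add: assms(1,2) minus_eq minus_add a_ac)
  finally show ?thesis .
qed

text \<open>The equations, taken in the order 1, 2, 3, 6, 5, 4, are the vertices met going around
  the hexagon; the shared summands \<open>m\<close>, \<open>p\<close>, \<open>q\<close>,
  \<open>s\<close>, \<open>r\<close>, \<open>n\<close> are its edges.\<close>

lemma (in abelian_group) hexagon_sum: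
  assumes "a1 \<oplus> m = b1 \<oplus> n" "a2 \<oplus> m = b2 \<oplus> p" "a3 \<oplus> q = b3 \<oplus> p"
    and "a4 \<oplus> r = b4 \<oplus> n" "a5 \<oplus> r = b5 \<oplus> s" "a6 \<oplus> q = b6 \<oplus> s"
    and carr: "{a1, a2, a3, a4, a5, a6, b1, b2, b3, b4, b5, b6, m, n, p, q, r, s} \<subseteq> carrier G"
  shows "(a1 \<ominus> a2) \<oplus> (b2 \<ominus> b3) \<oplus> (a3 \<ominus> a6) = (b1 \<ominus> b4) \<oplus> (a4 \<ominus> a5) \<oplus> (b5 \<ominus> b6)"
proof -
  have [simp]: "b1 \<in> carrier G" "b2 \<in> carrier G" "b3 \<in> carrier G" "b4 \<in> carrier G"
    "b5 \<in> carrier G" "b6 \<in> carrier G" "n \<in> carrier G" "p \<in> carrier G" "s \<in> carrier G"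
    using carr by simp_all
  \<comment> \<open>Pairing the equations along the edges \<open>m\<close>, \<open>q\<close> and
    \<open>r\<close> removes these three summands and leaves only differences of \<open>n\<close>,
    \<open>p\<close>, \<open>s\<close>.\<close>
  have "a1 \<ominus> a2 = (b1 \<ominus> b2) \<oplus> (n \<ominus> p)" "a3 \<ominus> a6 = (b3 \<ominus> b6) \<oplus> (p \<ominus> s)"
    and a45: "a4 \<ominus> a5 = (b4 \<ominus> b5) \<oplus> (n \<ominus> s)"
    using assms by (auto intro: add_eq_imp_minus_eq)
  then have "(a1 \<ominus> a2) \<oplus> (b2 \<ominus> b3) \<oplus> (a3 \<ominus> a6) =
      ((b1 \<ominus> b2) \<oplus> (b2 \<ominus> b3) \<oplus> (b3 \<ominus> b6)) \<oplus> ((n \<ominus> p) \<oplus> (p \<ominus> s))"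
    by (simp add: a_ac)
  \<comment> \<open>Both sides telescope to
    \<open>(b1 \<ominus> b6) \<oplus> (n \<ominus> s)\<close>; the detour through \<open>b4\<close>
    and \<open>b5\<close> prepares the use of \<open>a45\<close>.\<close>
  also have "\<dots> = ((b1 \<ominus> b4) \<oplus> (b4 \<ominus> b5) \<oplus> (b5 \<ominus> b6)) \<oplus> (n \<ominus> s)"
    by (simp add: minus_add_minus_cancel)
  also have "\<dots> = (b1 \<ominus> b4) \<oplus> (a4 \<ominus> a5) \<oplus> (b5 \<ominus> b6)"
    by (simp add: a45 a_ac)
  finally show ?thesis .
qed

theorem proposition6p4:
  fixes G :: "('a, 'm) monoid_scheme" (structure)
    and K :: "('k, 'n) ring_scheme"
    and c :: "'a \<Rightarrow> 'a \<Rightarrow> 'a \<Rightarrow> 'k"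
  assumes "group G"
    and "field K"
    and "c \<in> carrier G \<rightarrow> carrier G \<rightarrow> carrier G \<rightarrow> carrier K"
    and "\<And>x y z w. \<lbrakk>x \<in> carrier G; y \<in> carrier G; z \<in> carrier G; w \<in> carrier G\<rbrakk> \<Longrightarrow>
      c x y z \<oplus>\<^bsub>K\<^esub> c x (y \<otimes> z) w = c (x \<triangleleft> y) z w \<oplus>\<^bsub>K\<^esub> c x y (z \<otimes> w)"
  shows "rack_3_cocycle (carrier G) (conj_op G) K
    (\<lambda>x y z. c x y z \<ominus>\<^bsub>K\<^esub> c x z (inv z \<otimes> y \<otimes> z))"
proof -
  interpret G: group G by fact
  interpret K: field K by fact
  have c_closed [simp]: "c x y z \<in> carrier K"
    if "x \<in> carrier G" "y \<in> carrier G" "z \<in> carrier G" for x y z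
    using assms(3) that by blast
  have "rack_3_cocycle (carrier G) (conj_op G) K (\<lambda>x y z. c x y z \<ominus>\<^bsub>K\<^esub> c x z (y \<triangleleft> z))"
    unfolding rack_3_cocycle_def
  proof (intro conjI ballI)
    show "(\<lambda>x y z. c x y z \<ominus>\<^bsub>K\<^esub> c x z (y \<triangleleft> z)) \<in> carrier G \<rightarrow> carrier G \<rightarrow> carrier G \<rightarrow> carrier K"
      by simp
  next
    fix x y z w
    assume carr [simp]: "x \<in> carrier G" "y \<in> carrier G" "z \<in> carrier G" "w \<in> carrier G"
    \<comment> \<open>The letter \<open>y\<close> after it has been moved to the right past both
      \<open>z\<close> and \<open>w\<close>.\<close>
    let ?v = "y \<triangleleft> z \<triangleleft> w"
    \<comment> \<open>Each equation exchanges two adjacent letters. The last one is the exchange of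
      \<open>y\<close> and \<open>z\<close>, conjugated as a whole by \<open>w\<close>.\<close>
    have words: "z \<otimes> (y \<triangleleft> z) = y \<otimes> z" "w \<otimes> ?v = (y \<triangleleft> z) \<otimes> w" "w \<otimes> (z \<triangleleft> w) = z \<otimes> w"
      "w \<otimes> (y \<triangleleft> w) = y \<otimes> w" "(z \<triangleleft> w) \<otimes> ?v = (y \<triangleleft> w) \<otimes> (z \<triangleleft> w)"
      by (simp_all add: G.mult_conj_op G.conj_op_mult_left[symmetric])
    \<comment> \<open>The six sorted words, listed in the order of the premises of
      \<open>hexagon_sum\<close>. Rewriting with \<open>words\<close> makes the shared terms of
      neighbouring instances syntactically equal.\<close>
    note eqs = assms(4)[of x y z w] assms(4)[of x z "y \<triangleleft> z" w, unfolded words]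
      assms(4)[of x z w ?v, unfolded words] assms(4)[of x y w "z \<triangleleft> w", unfolded words]
      assms(4)[of x w "y \<triangleleft> w" "z \<triangleleft> w", unfolded words]
      assms(4)[of x w "z \<triangleleft> w" ?v, unfolded words]
    have "(c x y z \<ominus>\<^bsub>K\<^esub> c x z (y \<triangleleft> z)) \<oplus>\<^bsub>K\<^esub> (c (x \<triangleleft> z) (y \<triangleleft> z) w \<ominus>\<^bsub>K\<^esub> c (x \<triangleleft> z) w ?v)
        \<oplus>\<^bsub>K\<^esub> (c x z w \<ominus>\<^bsub>K\<^esub> c x w (z \<triangleleft> w)) =
      (c (x \<triangleleft> y) z w \<ominus>\<^bsub>K\<^esub> c (x \<triangleleft> y) w (z \<triangleleft> w)) \<oplus>\<^bsub>K\<^esub> (c x y w \<ominus>\<^bsub>K\<^esub> c x w (y \<triangleleft> w))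
        \<oplus>\<^bsub>K\<^esub> (c (x \<triangleleft> w) (y \<triangleleft> w) (z \<triangleleft> w) \<ominus>\<^bsub>K\<^esub> c (x \<triangleleft> w) (z \<triangleleft> w) ?v)"
      by (rule K.hexagon_sum[OF eqs]) simp_all
    \<comment> \<open>Only the last argument of the final term differs: it is \<open>y\<close>
      conjugated in the other order, equal to \<open>?v\<close> by self-distributivity.\<close>
    then show "(c x y z \<ominus>\<^bsub>K\<^esub> c x z (y \<triangleleft> z))
        \<oplus>\<^bsub>K\<^esub> (c (x \<triangleleft> z) (y \<triangleleft> z) w \<ominus>\<^bsub>K\<^esub> c (x \<triangleleft> z) w (y \<triangleleft> z \<triangleleft> w))
        \<oplus>\<^bsub>K\<^esub> (c x z w \<ominus>\<^bsub>K\<^esub> c x w (z \<triangleleft> w)) =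
      (c (x \<triangleleft> y) z w \<ominus>\<^bsub>K\<^esub> c (x \<triangleleft> y) w (z \<triangleleft> w)) \<oplus>\<^bsub>K\<^esub> (c x y w \<ominus>\<^bsub>K\<^esub> c x w (y \<triangleleft> w))
        \<oplus>\<^bsub>K\<^esub> (c (x \<triangleleft> w) (y \<triangleleft> w) (z \<triangleleft> w) \<ominus>\<^bsub>K\<^esub> c (x \<triangleleft> w) (z \<triangleleft> w) ((y \<triangleleft> w) \<triangleleft> (z \<triangleleft> w)))"
      by (simp add: G.conj_op_distrib)
  qed
  then show ?thesis
    by (simp add: conj_op_def)
qed

end
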